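(* For every real exponent $\alpha>1$ the mapping $p_2(p_3)$ is in the Pick Argument Lessening class $P$. That is, the quantity $p_2$, regarded as a function of the quantity $p_3$ via the correspondence $p_3(a)\mapsto p_2(a)$, $a\in(0,1)$, is (the restriction of) a function in $P$: there is $\varphi\in P$ with $\varphi(p_3(a))=p_2(a)$ for all $a\in(0,1)$.
   Context: Fix a real $\alpha>1$. For a real parameter $a\in(0,1)$ let $f_a(x)=-|x|^{\alpha}+a$ for $x\in\mathbb{R}$, and let $f_a^{n}$ denote the $n$-th iterate, with $f_a^0(0)=0$. Define $p_2=p_2(a)=(1-a^{\alpha-1})^{-1}$ (equivalently $p_2=f_a(0)/f_a^2(0)$), and for $n\ge 3$ $$p_n=p_n(a)=\frac{f_a^{n-3}(0)-f_a^{n}(0)}{f_a^{n-3}(0)-f_a^{n-1}(0)}\cdot\frac{f_a^{n-1}(0)-f_a^{n-2}(0)}{f_a^{n}(0)-f_a^{n-2}(0)}.$$ In particular $$p_3(a)=\frac{f_a^{3}(0)}{f_a^{2}(0)}\cdot\frac{f_a^{2}(0)-f_a(0)}{f_a^{3}(0)-f_a(0)}.$$ Let $\mathbf{H}=\{z\in\mathbb{C}:\operatorname{Im} z>0\}$. The class $P$ of Pick Argument Lessening functions consists of all functions $\varphi$ analytic in $\mathbf{H}$ such that: (i) $\operatorname{Im}\varphi(z)>0$ for all $z\in\mathbf{H}$; (ii) $\varphi$ can be analytically continued by (Schwarz) reflection through the half-axis $(1,+\infty)$, so that $\varphi$ is defined, analytic and real-valued on $(1,+\infty)$; (iii) $\varphi$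 fixes $1$, i.e. $\varphi$ extends continuously along the reals to $1$ with $\varphi(1)=\lim_{x\to1^+}\varphi(x)=1$. *)

theory Defs
  imports "HOL-Complex_Analysis.Complex_Analysis"
begin

definition fmap :: "real \<Rightarrow> real \<Rightarrow> real \<Rightarrow> real" where
  "fmap \<alpha> a x = - (\<bar>x\<bar> powr \<alpha>) + a"

abbreviation orb :: "real \<Rightarrow> real \<Rightarrow> nat \<Rightarrow> real" where
  "orb \<alpha> a n \<equiv> (fmap \<alpha> a ^^ n) 0"

text \<open>Only the values for \<open>n \<ge> 2\<close> are meaningful; for \<open>n < 2\<close> the subtractions on
  indices truncate.\<close>

definition p :: "nat \<Rightarrow> real \<Rightarrow> real \<Rightarrow> real" where
  "p n \<alpha> a =
    (if n = 2 then inverse (1 - a powr (\<alpha> - 1))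
     else (orb \<alpha> a (n - 3) - orb \<alpha> a n) / (orb \<alpha> a (n - 3) - orb \<alpha> a (n - 1))
        * ((orb \<alpha> a (n - 1) - orb \<alpha> a (n - 2)) / (orb \<alpha> a n - orb \<alpha> a (n - 2))))"

lemma p_2_eq_orb_quotient:
  assumes "0 < a"
  shows "p 2 \<alpha> a = orb \<alpha> a 1 / orb \<alpha> a 2"
proof -
  have "a powr \<alpha> = a * a powr (\<alpha> - 1)"
    using assms by (simp add: powr_mult_base)
  then have "a - a powr \<alpha> = a * (1 - a powr (\<alpha> - 1))"
    by (simp add: algebra_simps)
  then show ?thesis
    using assms by (simp add: p_def fmap_def numeral_2_eq_2 inverse_eq_divide)
qed

lemma p_3_eq:
  "p 3 \<alpha> a = orb \<alpha> a 3 / orb \<alpha> a 2 *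
     ((orb \<alpha> a 2 - orb \<alpha> a 1) / (orb \<alpha> a 3 - orb \<alpha> a 1))"
  by (simp add: p_def)

definition upper_half_plane :: "complex set" where
  "upper_half_plane = {z. Im z > 0}"

definition ray :: "complex set" where
  "ray = complex_of_real ` {1<..}"

text \<open>An element of the class is represented by its continuation to the slit plane
  \<open>H \<union> (1, \<infinity>) \<union> cnj ` H\<close>, together with its boundary value at \<open>1\<close>; its values
  on \<open>(-\<infinity>, 1)\<close> are irrelevant. The third and fourth conjuncts express that this
  continuation is the Schwarz reflection through \<open>(1, \<infinity>)\<close>.\<close>

definition PAL_class :: "(complex \<Rightarrow> complex) set" where
  "PAL_class = {\<phi>.
     \<phi> analytic_on (upper_half_plane \<union> ray \<union> cnj ` upper_half_plane) \<and>
     (\<forall>z \<in> upper_half_plane. Im (\<phi> z) > 0) \<and>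
     (\<forall>z \<in> upper_half_plane. \<phi> (cnj z) = cnj (\<phi> z)) \<and>
     (\<forall>z \<in> ray. \<phi> z \<in> \<real>) \<and>
     \<phi> 1 = 1 \<and>
     ((\<lambda>x. \<phi> (complex_of_real x)) \<longlongrightarrow> 1) (at_right 1)}"

end

theory Submission
  imports Defs
begin

text \<open>
  Write \<open>w = p 2 \<alpha> a\<close> and \<open>\<beta> = \<alpha> + 1\<close>. As \<open>a\<close> runs through \<open>(0, 1)\<close>, \<open>w\<close> stays in
  \<open>(1, \<infinity>)\<close>, and a computation with the first three points of the critical orbit
  (\<open>p_3_eq_powr_minus_id\<close>) eliminates \<open>a\<close>: \<open>p 3 \<alpha> a = w powr \<beta> - w + 1\<close>. So the claim
  is that the inverse of \<open>w \<mapsto> w powr \<beta> - w + 1\<close> on \<open>(1, \<infinity>)\<close> extends to a Pick function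
  on the plane slit along \<open>(-\<infinity>, 1]\<close> (\<open>PAL_inverse_of_powr_minus_id\<close>).

  Put \<open>\<zeta> = w powr \<beta>\<close> and \<open>\<gamma> = 1 / \<beta>\<close>. Solving \<open>w powr \<beta> - w + 1 = z\<close> then means
  \<open>\<zeta> - \<zeta> powr \<gamma> = c\<close> with \<open>c = z - 1\<close>, which is the fixed point equation
  \<open>\<zeta> = c + \<zeta> powr \<gamma>\<close>. The gain is that \<open>\<zeta> \<mapsto> \<zeta> powr \<gamma>\<close> is a holomorphic self-map of the
  upper half-plane, so that for \<open>Im c > 0\<close> the right-hand side maps the half-plane
  \<open>Im \<zeta> > 0\<close> into the smaller half-plane \<open>Im \<zeta> > Im c\<close>. Such a map strictly contracts the
  hyperbolic metric, so it has at most one fixed point; this is the injectivity statement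
  \<open>inj_on_diff_half_plane_self_map\<close>, a consequence of the Schwarz-Pick lemma. Since
  \<open>\<zeta> powr \<gamma>\<close> grows sublinearly, the right-hand side also maps the part
  of a large disc where \<open>Im \<zeta> \<ge> Im c\<close> into itself, and Brouwer's theorem gives a fixed point
  (\<open>minus_powr_solvable_upper\<close>). Conjugation treats \<open>Im c < 0\<close>, and monotonicity on
  the reals treats \<open>c > 0\<close>.

  To get analyticity across the real axis without a limiting argument, all this is arranged
  on one open, conjugation-invariant set, \<open>univalence_region \<gamma>\<close>, on which
  \<open>\<zeta> \<mapsto> \<zeta> - \<zeta> powr \<gamma>\<close> is injective and whose image contains the plane slit along
  \<open>(-\<infinity>, 0]\<close>. The inverse \<open>g\<close> is therefore holomorphic on the slit plane, and
  \<open>\<phi> z = g (z - 1) powr \<gamma>\<close> is the function sought: it has positive imaginary part because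
  both \<open>g\<close> and the power preserve the upper half-plane.
\<close>

section \<open>Self-maps of the upper half-plane\<close>

lemma cmod_diff_cnj_square:
  "(cmod (v - cnj b))\<^sup>2 = (cmod (v - b))\<^sup>2 + 4 * Im v * Im b"
  by (simp only: cmod_power2) (simp add: power2_eq_square algebra_simps)

text \<open>The upper half-plane as the set of points nearer to \<open>b\<close> than to its mirror image. In this
  form membership in the half-plane becomes the condition that the Cayley transform based at
  \<open>b\<close> takes values in the unit disc.\<close>

lemma cmod_diff_less_cnj_iff:
  assumes "0 < Im b"
  shows "cmod (v - b) < cmod (v - cnj b) \<longleftrightarrow> 0 < Im v"
proof -
  have "cmod (v - b) < cmod (v - cnj b) \<longleftrightarrow> (cmod (v - b))\<^sup>2 < (cmod (v - cnj b))\<^sup>2"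
    by (metis norm_ge_zero power2_less_imp_less power_strict_mono zero_less_numeral)
  also have "\<dots> \<longleftrightarrow> 0 < Im v"
    using assms by (simp add: cmod_diff_cnj_square zero_less_mult_iff)
  finally show ?thesis .
qed

text \<open>Schwarz's lemma, transported to the half-plane by the Cayley transforms that send \<open>b\<close>
  and \<open>f b\<close> to the origin. The quotients are cleared of denominators.\<close>

lemma Schwarz_Pick_half_plane:
  assumes hol: "f holomorphic_on {z. 0 < Im z}"
    and into: "\<And>z. 0 < Im z \<Longrightarrow> 0 < Im (f z)"
    and z: "0 < Im z" and b: "0 < Im b"
  shows "cmod (f z - f b) * cmod (z - cnj b) \<le> cmod (z - b) * cmod (f z - cnj (f b))"
proof -
  \<comment> \<open>\<open>D\<close> is the inverse of the Cayley transform \<open>z \<mapsto> (z - b) / (z - cnj b)\<close>.\<close>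
  define D where "D \<zeta> = (b - cnj b * \<zeta>) / (1 - \<zeta>)" for \<zeta>
  define h where "h \<zeta> = (f (D \<zeta>) - f b) / (f (D \<zeta>) - cnj (f b))" for \<zeta>
  have ne: "v - cnj c \<noteq> 0" if "0 < Im v" "0 < Im c" for v c
    using that by (auto simp: complex_eq_iff)
  have D_upper: "0 < Im (D \<zeta>)" if "cmod \<zeta> < 1" for \<zeta>
  proof -
    have "\<zeta> \<noteq> 1" using that by auto
    then have 1: "D \<zeta> - b = \<zeta> * ((b - cnj b) / (1 - \<zeta>))"
      and 2: "D \<zeta> - cnj b = (b - cnj b) / (1 - \<zeta>)"
      by (simp_all add: D_def field_simps)
    have "0 < cmod ((b - cnj b) / (1 - \<zeta>))"
      using \<open>\<zeta> \<noteq> 1\<close> ne[OF b b] by simp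
    then have "cmod (D \<zeta> - b) < cmod (D \<zeta> - cnj b)"
      unfolding 1 2 norm_mult using that by simp
    then show ?thesis
      using cmod_diff_less_cnj_iff[OF b] by blast
  qed
  have holD: "D holomorphic_on ball 0 1"
    unfolding D_def by (intro holomorphic_intros) auto
  have holfD: "(\<lambda>\<zeta>. f (D \<zeta>)) holomorphic_on ball 0 1"
    using holomorphic_on_compose_gen[OF holD hol] D_upper by (force simp: o_def)
  have holh: "h holomorphic_on ball 0 1"
    unfolding h_def
    by (intro holomorphic_intros holfD) (use ne D_upper into b in auto)
  have h_less: "cmod (h \<zeta>) < 1" if "cmod \<zeta> < 1" for \<zeta>
    using cmod_diff_less_cnj_iff[OF into[OF b], of "f (D \<zeta>)"] into[OF D_upper[OF that]]
      ne[OF into[OF D_upper[OF that]] into[OF b]]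
    by (simp add: h_def norm_divide divide_less_eq_1)
  define \<zeta> where "\<zeta> = (z - b) / (z - cnj b)"
  have \<zeta>: "cmod \<zeta> < 1"
    using cmod_diff_less_cnj_iff[OF b, of z] z ne[OF z b]
    by (simp add: \<zeta>_def norm_divide divide_less_eq_1)
  have "D \<zeta> = z"
  proof -
    have "1 - \<zeta> = (b - cnj b) / (z - cnj b)" "b - cnj b * \<zeta> = z * ((b - cnj b) / (z - cnj b))"
      using ne[OF z b] by (simp_all add: \<zeta>_def field_simps)
    then show ?thesis
      using ne[OF z b] ne[OF b b] by (simp add: D_def)
  qed
  moreover have "cmod (h \<zeta>) \<le> cmod \<zeta>"
    by (rule Schwarz_Lemma(1)[OF holh _ h_less \<zeta>]) (simp_all add: h_def D_def)
  ultimately have "cmod (f z - f b) / cmod (f z - cnj (f b)) \<le> cmod (z - b) / cmod (z - cnj b)"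
    by (simp add: h_def \<zeta>_def norm_divide)
  then show ?thesis
    using ne[OF z b] ne[OF into[OF z] into[OF b]] by (simp add: field_simps)
qed

text \<open>If \<open>z - f z = b - f b\<close>, then \<open>f\<close> displaces \<open>z\<close> and \<open>b\<close> by the same vector, which leaves
  their Euclidean distance unchanged and moves both strictly towards the boundary. That
  increases their hyperbolic distance, against Schwarz-Pick, unless \<open>z = b\<close>.\<close>

lemma inj_on_diff_half_plane_self_map:
  assumes hol: "f holomorphic_on {z. 0 < Im z}"
    and into: "\<And>z. 0 < Im z \<Longrightarrow> 0 < Im (f z)"
  shows "inj_on (\<lambda>z. z - f z) {z. 0 < Im z \<and> 0 < Im (z - f z)}"
proof (rule inj_onI, rule ccontr)
  fix z b
  assume "z \<in> {z. 0 < Im z \<and> 0 < Im (z - f z)}" "b \<in> {z. 0 < Im z \<and> 0 < Im (z - f z)}"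
    and eq: "z - f z = b - f b" and "z \<noteq> b"
  then have z: "0 < Im z" "Im (f z) < Im z" and b: "0 < Im b" "Im (f b) < Im b"
    by auto
  have d: "f z - f b = z - b"
    using eq by (simp add: algebra_simps)
  have "cmod (z - cnj b) \<le> cmod (f z - cnj (f b))"
    using Schwarz_Pick_half_plane[OF hol into z(1) b(1)] \<open>z \<noteq> b\<close> by (simp add: d)
  then have "(cmod (z - cnj b))\<^sup>2 \<le> (cmod (f z - cnj (f b)))\<^sup>2"
    by (simp add: power_mono)
  then have "Im z * Im b \<le> Im (f z) * Im (f b)"
    by (simp add: cmod_diff_cnj_square d)
  moreover have "Im (f z) * Im (f b) < Im z * Im b"
    by (rule mult_strict_mono) (use z b into[of b] in auto)
  ultimately show False by simp
qed

section \<open>The map subtracting a fractional power\<close>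

definition minus_powr :: "real \<Rightarrow> complex \<Rightarrow> complex" where
  "minus_powr \<gamma> \<zeta> = \<zeta> - \<zeta> powr of_real \<gamma>"

lemma Im_powr_of_real:
  assumes "\<zeta> \<noteq> 0"
  shows "Im (\<zeta> powr of_real \<gamma>) = cmod \<zeta> powr \<gamma> * sin (\<gamma> * Im (Ln \<zeta>))"
  using assms by (simp add: powr_def Im_exp)

lemma Im_powr_pos:
  assumes "0 < \<gamma>" "\<gamma> < 1" "0 < Im \<zeta>"
  shows "0 < Im (\<zeta> powr of_real \<gamma>)"
proof -
  have "\<zeta> \<noteq> 0" using assms by auto
  have "0 < Im (Ln \<zeta>)" "Im (Ln \<zeta>) < pi"
    using Im_Ln_pos_lt_imp[OF assms(3)] by auto
  moreover from this assms have "\<gamma> * Im (Ln \<zeta>) < 1 * pi"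
    by (intro mult_strict_mono) auto
  ultimately have "0 < sin (\<gamma> * Im (Ln \<zeta>))"
    using assms by (intro sin_gt_zero) auto
  then show ?thesis
    using \<open>\<zeta> \<noteq> 0\<close> by (simp add: Im_powr_of_real)
qed

text \<open>With \<open>\<theta>\<close> the argument of \<open>\<zeta>\<close>, passing to the power lowers both factors of
  \<open>Im \<zeta> = cmod \<zeta> * sin \<theta>\<close>: the modulus because it exceeds 1, and the sine because it is
  increasing up to a right angle.\<close>

lemma Im_powr_less:
  assumes "0 < \<gamma>" "\<gamma> < 1" "0 < Im \<zeta>" "0 < Re \<zeta>" "1 < cmod \<zeta>"
  shows "Im (\<zeta> powr of_real \<gamma>) < Im \<zeta>"
proof -
  define \<theta> where "\<theta> = Im (Ln \<zeta>)"
  have "\<zeta> \<noteq> 0" using assms by auto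
  have \<theta>: "0 < \<theta>" "\<theta> < pi / 2"
    using Im_Ln_pos_lt_imp[OF assms(3)] Re_Ln_pos_lt_imp[OF assms(4)] by (auto simp: \<theta>_def)
  have Im: "Im \<zeta> = cmod \<zeta> * sin \<theta>"
    using Im_powr_of_real[OF \<open>\<zeta> \<noteq> 0\<close>, of 1] by (simp add: \<theta>_def)
  have le: "\<gamma> * \<theta> < 1 * \<theta>"
    using assms \<theta> by (intro mult_strict_right_mono) auto
  have "sin (\<gamma> * \<theta>) < sin \<theta>"
  proof (rule sin_monotone_2pi)
    have "0 < \<gamma> * \<theta>" using assms \<theta> by simp
    then show "- (pi / 2) \<le> \<gamma> * \<theta>" using pi_gt_zero by linarith
  qed (use le \<theta> in auto)
  moreover have "cmod \<zeta> powr \<gamma> < cmod \<zeta> powr 1"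
    using assms by (intro powr_less_mono) auto
  moreover have "0 < sin (\<gamma> * \<theta>)"
    using le \<theta> assms by (intro sin_gt_zero) (simp, linarith)
  ultimately have "cmod \<zeta> powr \<gamma> * sin (\<gamma> * \<theta>) < cmod \<zeta> powr 1 * sin \<theta>"
    using assms by (intro mult_strict_mono) auto
  then show ?thesis
    using \<open>\<zeta> \<noteq> 0\<close> assms by (simp add: Im Im_powr_of_real \<theta>_def)
qed

lemma holomorphic_minus_powr: "minus_powr \<gamma> holomorphic_on - \<real>\<^sub>\<le>\<^sub>0"
  unfolding minus_powr_def by (intro holomorphic_intros) auto

lemma cnj_minus_powr:
  assumes "\<zeta> \<notin> \<real>\<^sub>\<le>\<^sub>0"
  shows "minus_powr \<gamma> (cnj \<zeta>) = cnj (minus_powr \<gamma> \<zeta>)"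
  using assms by (subst (asm) complex_nonpos_Reals_iff) (auto simp: minus_powr_def cnj_powr)

lemma minus_powr_real:
  assumes "0 \<le> x"
  shows "minus_powr \<gamma> (of_real x) = of_real (x - x powr \<gamma>)"
  using assms by (simp add: minus_powr_def powr_of_real)

text \<open>Brouwer's theorem for \<open>\<zeta> \<mapsto> \<zeta> powr \<gamma> + c\<close> on the part of a large disc where
  \<open>Im \<zeta> \<ge> Im c\<close>; staying off the real axis keeps the power continuous.\<close>

lemma minus_powr_solvable_upper:
  assumes \<gamma>: "0 < \<gamma>" "\<gamma> \<le> 1 / 2" and c: "0 < Im c"
  obtains \<zeta> where "0 < Im \<zeta>" "minus_powr \<gamma> \<zeta> = c"
proof -
  \<comment> \<open>The radius must satisfy \<open>R powr \<gamma> + cmod c \<le> R\<close>; as \<open>\<gamma> \<le> 1 / 2\<close>, it suffices that the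
      square root of \<open>R\<close> is \<open>1 + cmod c\<close>.\<close>
  define R where "R = (1 + cmod c)\<^sup>2"
  define S where "S = {z. Im c \<le> Im z} \<inter> cball 0 R"
  have R1: "1 \<le> R" "1 + cmod c = R powr (1 / 2)"
    by (auto simp: R_def one_le_power powr_half_sqrt)
  have R: "R powr \<gamma> + cmod c \<le> R"
  proof -
    have "R powr \<gamma> \<le> R powr (1 / 2)"
      using R1 \<gamma> by (intro powr_mono) auto
    then have "R powr \<gamma> + cmod c \<le> 1 + 2 * cmod c"
      using R1 by linarith
    also have "\<dots> \<le> R"
      by (simp add: R_def power2_eq_square algebra_simps)
    finally show ?thesis .
  qed
  obtain \<zeta> where "\<zeta> \<in> S" "\<zeta> powr of_real \<gamma> + c = \<zeta>"
  proof (rule brouwer)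
    show "compact S"
      unfolding S_def by (intro closed_Int_compact closed_halfspace_Im_ge compact_cball)
    show "convex S"
      unfolding S_def by (intro convex_Int convex_halfspace_Im_ge convex_cball)
    have "cmod c \<le> R"
      using R powr_ge_zero[of R \<gamma>] by linarith
    then show "S \<noteq> {}"
      by (auto simp: S_def)
    show "continuous_on S (\<lambda>\<zeta>. \<zeta> powr of_real \<gamma> + c)"
      using c \<gamma> by (intro continuous_intros) (auto simp: S_def)
    show "(\<lambda>\<zeta>. \<zeta> powr of_real \<gamma> + c) \<in> S \<rightarrow> S"
    proof
      fix z assume z: "z \<in> S"
      have "0 < Im (z powr of_real \<gamma>)"
        using \<gamma> c z by (intro Im_powr_pos) (auto simp: S_def)
      moreover have "cmod (z powr of_real \<gamma> + c) \<le> R"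
      proof -
        have "cmod (z powr of_real \<gamma> + c) \<le> cmod z powr \<gamma> + cmod c"
          by (rule order_trans[OF norm_triangle_ineq]) (simp add: norm_powr_real_powr')
        also have "\<dots> \<le> R powr \<gamma> + cmod c"
          using z \<gamma> by (auto simp: S_def intro!: powr_mono2)
        finally show ?thesis using R by linarith
      qed
      ultimately show "z powr of_real \<gamma> + c \<in> S"
        by (simp add: S_def)
    qed
  qed
  moreover from this have "0 < Im \<zeta>" "minus_powr \<gamma> \<zeta> = c"
    using c by (auto simp: S_def minus_powr_def algebra_simps)
  ultimately show thesis
    using that by blast
qed

lemma real_minus_powr_strict_mono:
  fixes x y :: real
  assumes "0 < \<gamma>" "\<gamma> < 1" "1 \<le> x" "x < y"
  shows "x - x powr \<gamma> < y - y powr \<gamma>"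
proof -
  \<comment> \<open>a product of a positive and a nonnegative increasing factor\<close>
  have split: "t - t powr \<gamma> = t powr \<gamma> * (t powr (1 - \<gamma>) - 1)" if "1 \<le> t" for t :: real
    using that by (simp add: algebra_simps flip: powr_add)
  have "x powr \<gamma> < y powr \<gamma>" "x powr (1 - \<gamma>) < y powr (1 - \<gamma>)"
    using assms by (auto intro!: powr_less_mono2)
  moreover have "1 \<le> x powr (1 - \<gamma>)"
    using assms by (intro ge_one_powr_ge_zero) auto
  ultimately have "x powr \<gamma> * (x powr (1 - \<gamma>) - 1) < y powr \<gamma> * (y powr (1 - \<gamma>) - 1)"
    using assms by (intro mult_strict_mono) auto
  then show ?thesis
    using assms by (simp add: split)
qed

text \<open>The points off the real axis whose side of the axis is preserved by \<open>minus_powr \<gamma>\<close> form the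
  natural domain of injectivity, but they omit the real points needed as preimages of
  \<open>(0, \<infinity>)\<close>. The second part adds them together with a neighbourhood. Off the real axis, that
  neighbourhood lies in the first part already (by \<open>Im_powr_less\<close>), so the side is preserved
  throughout.\<close>

definition univalence_region :: "real \<Rightarrow> complex set" where
  "univalence_region \<gamma> =
     {\<zeta>. \<zeta> \<notin> \<real>\<^sub>\<le>\<^sub>0 \<and> 0 < Im \<zeta> * Im (minus_powr \<gamma> \<zeta>)} \<union> {\<zeta>. 0 < Re \<zeta> \<and> 1 < cmod \<zeta>}"

lemma univalence_region_avoids_slit: "univalence_region \<gamma> \<subseteq> - \<real>\<^sub>\<le>\<^sub>0"
  by (auto simp: univalence_region_def complex_nonpos_Reals_iff)

lemma open_univalence_region: "open (univalence_region \<gamma>)"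
proof -
  have "continuous_on (- \<real>\<^sub>\<le>\<^sub>0) (\<lambda>\<zeta>. Im \<zeta> * Im (minus_powr \<gamma> \<zeta>))"
    by (intro continuous_intros holomorphic_on_imp_continuous_on holomorphic_minus_powr)
  then have "open (- \<real>\<^sub>\<le>\<^sub>0 \<inter> (\<lambda>\<zeta>. Im \<zeta> * Im (minus_powr \<gamma> \<zeta>)) -` {0<..})"
    by (rule continuous_open_preimage) (auto simp: open_Compl)
  moreover have "open ({\<zeta>. 0 < Re \<zeta>} \<inter> {\<zeta>. 1 < cmod \<zeta>})"
    by (intro open_Int open_halfspace_Re_gt open_Collect_less continuous_intros)
  moreover have "univalence_region \<gamma> =
      (- \<real>\<^sub>\<le>\<^sub>0 \<inter> (\<lambda>\<zeta>. Im \<zeta> * Im (minus_powr \<gamma> \<zeta>)) -` {0<..}) \<union>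
      ({\<zeta>. 0 < Re \<zeta>} \<inter> {\<zeta>. 1 < cmod \<zeta>})"
    by (auto simp: univalence_region_def)
  ultimately show ?thesis
    by (metis open_Un)
qed

lemma cnj_univalence_region:
  assumes "\<zeta> \<in> univalence_region \<gamma>"
  shows "cnj \<zeta> \<in> univalence_region \<gamma>"
  using assms univalence_region_avoids_slit[of \<gamma>]
  by (auto simp: univalence_region_def cnj_minus_powr complex_nonpos_Reals_iff)

lemma Im_minus_powr_pos:
  assumes \<gamma>: "0 < \<gamma>" "\<gamma> < 1" and \<zeta>: "\<zeta> \<in> univalence_region \<gamma>" and "0 < Im \<zeta>"
  shows "0 < Im (minus_powr \<gamma> \<zeta>)"
  using \<zeta> unfolding univalence_region_def
proof
  assume "\<zeta> \<in> {\<zeta>. 0 < Re \<zeta> \<and> 1 < cmod \<zeta>}"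
  then show ?thesis
    using Im_powr_less[OF \<gamma> \<open>0 < Im \<zeta>\<close>] by (simp add: minus_powr_def)
qed (use \<open>0 < Im \<zeta>\<close> in \<open>auto simp: zero_less_mult_iff\<close>)

lemma univalence_region_real:
  assumes "\<zeta> \<in> univalence_region \<gamma>" "Im \<zeta> = 0"
  shows "\<exists>x>1. \<zeta> = of_real x"
  using assms by (auto simp: univalence_region_def cmod_eq_Re complex_eq_iff intro!: exI[of _ "Re \<zeta>"])

lemma sgn_Im_minus_powr:
  assumes \<gamma>: "0 < \<gamma>" "\<gamma> < 1" and \<zeta>: "\<zeta> \<in> univalence_region \<gamma>"
  shows "sgn (Im (minus_powr \<gamma> \<zeta>)) = sgn (Im \<zeta>)"
proof -
  consider "0 < Im \<zeta>" | "Im \<zeta> = 0" | "Im \<zeta> < 0" by linarith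
  then show ?thesis
  proof cases
    case 1
    then show ?thesis using Im_minus_powr_pos[OF \<gamma> \<zeta>] by simp
  next
    case 2
    then obtain x where "x > 1" "\<zeta> = of_real x"
      using univalence_region_real[OF \<zeta>] by blast
    then show ?thesis by (simp add: minus_powr_real)
  next
    case 3
    have "\<zeta> \<notin> \<real>\<^sub>\<le>\<^sub>0"
      using \<zeta> univalence_region_avoids_slit by blast
    then show ?thesis
      using Im_minus_powr_pos[OF \<gamma> cnj_univalence_region[OF \<zeta>]] 3
      by (simp add: cnj_minus_powr)
  qed
qed

lemma inj_on_minus_powr_upper:
  assumes \<gamma>: "0 < \<gamma>" "\<gamma> < 1"
  shows "inj_on (minus_powr \<gamma>) {\<zeta> \<in> univalence_region \<gamma>. 0 < Im \<zeta>}"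
proof -
  have "inj_on (\<lambda>\<zeta>. \<zeta> - \<zeta> powr of_real \<gamma>)
          {\<zeta>. 0 < Im \<zeta> \<and> 0 < Im (\<zeta> - \<zeta> powr of_real \<gamma>)}"
  proof (rule inj_on_diff_half_plane_self_map)
    show "(\<lambda>\<zeta>. \<zeta> powr of_real \<gamma>) holomorphic_on {z. 0 < Im z}"
      by (intro holomorphic_intros) (auto simp: complex_nonpos_Reals_iff)
  qed (use Im_powr_pos[OF \<gamma>] in auto)
  then show ?thesis
    unfolding minus_powr_def[symmetric] by (rule inj_on_subset) (use Im_minus_powr_pos[OF \<gamma>] in auto)
qed

text \<open>Two points with the same value lie on the same side of the real axis or both on it, by
  \<open>sgn_Im_minus_powr\<close>. This reduces injectivity to the upper half, its mirror image, and the
  real ray beyond 1.\<close>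

lemma inj_on_minus_powr:
  assumes \<gamma>: "0 < \<gamma>" "\<gamma> < 1"
  shows "inj_on (minus_powr \<gamma>) (univalence_region \<gamma>)"
proof (rule inj_onI)
  fix \<zeta> \<xi>
  assume mem: "\<zeta> \<in> univalence_region \<gamma>" "\<xi> \<in> univalence_region \<gamma>"
    and eq: "minus_powr \<gamma> \<zeta> = minus_powr \<gamma> \<xi>"
  have slit: "\<zeta> \<notin> \<real>\<^sub>\<le>\<^sub>0" "\<xi> \<notin> \<real>\<^sub>\<le>\<^sub>0"
    using mem univalence_region_avoids_slit by blast+
  have sgn: "sgn (Im \<zeta>) = sgn (Im \<xi>)"
    using sgn_Im_minus_powr[OF \<gamma>] mem eq by metis
  consider "0 < Im \<zeta>" "0 < Im \<xi>" | "Im \<zeta> = 0" "Im \<xi> = 0" | "Im \<zeta> < 0" "Im \<xi> < 0"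
    using sgn by (auto simp: sgn_if split: if_splits)
  then show "\<zeta> = \<xi>"
  proof cases
    case 1
    then show ?thesis
      using inj_onD[OF inj_on_minus_powr_upper[OF \<gamma>] eq] mem by auto
  next
    case 2
    then obtain x y where x: "x > 1" "\<zeta> = of_real x" and y: "y > 1" "\<xi> = of_real y"
      using univalence_region_real mem by metis
    then have "x - x powr \<gamma> = y - y powr \<gamma>"
      using eq by (simp only: minus_powr_real of_real_eq_iff)
    then have "x = y"
      using real_minus_powr_strict_mono[OF \<gamma>, of x y] real_minus_powr_strict_mono[OF \<gamma>, of y x] x y
      by linarith
    then show ?thesis using x y by simp
  next
    case 3
    have "cnj \<zeta> = cnj \<xi>"
      using inj_onD[OF inj_on_minus_powr_upper[OF \<gamma>], of "cnj \<zeta>" "cnj \<xi>"]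
        mem eq 3 slit cnj_univalence_region
      by (auto simp: cnj_minus_powr)
    then show ?thesis by simp
  qed
qed

section \<open>The inverse function and the class of Pick functions\<close>

text \<open>The bound \<open>w \<le> x\<close> is what later forces the inverse function to tend to 1 as \<open>x\<close>
  decreases to 1.\<close>

lemma powr_minus_id_solvable:
  fixes x :: real
  assumes "2 \<le> \<beta>" "1 < x"
  obtains w where "1 < w" "w \<le> x" "w powr \<beta> - w + 1 = x"
proof -
  have "x * (x - 1) \<ge> 1 * (x - 1)"
    using assms by (intro mult_right_mono) auto
  moreover have "x powr 2 \<le> x powr \<beta>"
    using assms by (intro powr_mono) auto
  ultimately have "x \<le> x powr \<beta> - x + 1"
    using assms by (simp add: power2_eq_square algebra_simps)
  moreover have "continuous_on {1..x} (\<lambda>w. w powr \<beta> - w + 1)"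
    using assms by (intro continuous_intros) auto
  ultimately obtain w where w: "1 \<le> w" "w \<le> x" "w powr \<beta> - w + 1 = x"
    using IVT'[of "\<lambda>w. w powr \<beta> - w + 1" 1 x x] assms by auto
  have "w \<noteq> 1" using w assms by auto
  then show thesis using that[of w] w by simp
qed

lemma minus_powr_of_real_powr:
  assumes "0 < \<beta>" "1 < w"
  shows "minus_powr (1 / \<beta>) (of_real (w powr \<beta>)) = of_real (w powr \<beta> - w)"
  using assms by (subst minus_powr_real) (simp_all add: powr_powr)

lemma slit_plane_subset_image_minus_powr:
  assumes "2 \<le> \<beta>"
  shows "- \<real>\<^sub>\<le>\<^sub>0 \<subseteq> minus_powr (1 / \<beta>) ` univalence_region (1 / \<beta>)"
proof
  let ?\<gamma> = "1 / \<beta>"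
  have \<gamma>: "0 < ?\<gamma>" "?\<gamma> \<le> 1 / 2" "?\<gamma> < 1"
    using assms by (auto simp: field_simps)
  have upper: "c \<in> minus_powr ?\<gamma> ` univalence_region ?\<gamma>" if c: "0 < Im c" for c
  proof -
    obtain \<zeta> where "0 < Im \<zeta>" "minus_powr ?\<gamma> \<zeta> = c"
      using minus_powr_solvable_upper[OF \<gamma>(1,2) c] .
    moreover from this have "\<zeta> \<in> univalence_region ?\<gamma>"
      using c by (auto simp: univalence_region_def complex_nonpos_Reals_iff)
    ultimately show ?thesis by blast
  qed
  fix c :: complex
  assume c: "c \<in> - \<real>\<^sub>\<le>\<^sub>0"
  consider "0 < Im c" | "Im c = 0" | "Im c < 0" by linarith
  then show "c \<in> minus_powr ?\<gamma> ` univalence_region ?\<gamma>"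
  proof cases
    case 1
    then show ?thesis by (rule upper)
  next
    case 2
    then have "0 < Re c" and c_eq: "c = of_real (Re c)"
      using c by (auto simp: complex_nonpos_Reals_iff complex_eq_iff)
    then obtain w where w: "1 < w" "w powr \<beta> - w + 1 = Re c + 1"
      using powr_minus_id_solvable[OF assms, of "Re c + 1"] by auto
    have "1 < w powr \<beta>"
      using w assms by (intro gr_one_powr) auto
    then have "of_real (w powr \<beta>) \<in> univalence_region ?\<gamma>"
      by (auto simp: univalence_region_def)
    moreover have "minus_powr ?\<gamma> (of_real (w powr \<beta>)) = c"
      using w assms by (subst c_eq) (simp add: minus_powr_of_real_powr)
    ultimately show ?thesis by blast
  next
    case 3
    then obtain \<zeta> where \<zeta>: "\<zeta> \<in> univalence_region ?\<gamma>" "cnj c = minus_powr ?\<gamma> \<zeta>"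
      using upper[of "cnj c"] by auto
    then have "\<zeta> \<notin> \<real>\<^sub>\<le>\<^sub>0"
      using univalence_region_avoids_slit by blast
    then have "minus_powr ?\<gamma> (cnj \<zeta>) = c"
      using \<zeta>(2) by (metis cnj_minus_powr complex_cnj_cnj)
    then show ?thesis
      using cnj_univalence_region[OF \<zeta>(1)] by blast
  qed
qed

lemma PAL_inverse_of_powr_minus_id:
  assumes \<beta>: "2 \<le> \<beta>"
  obtains \<phi> where "\<phi> \<in> PAL_class"
    "\<And>w::real. 1 < w \<Longrightarrow> \<phi> (of_real (w powr \<beta> - w + 1)) = of_real w"
proof -
  let ?\<gamma> = "1 / \<beta>" and ?\<Omega> = "univalence_region (1 / \<beta>)"
  let ?D = "upper_half_plane \<union> ray \<union> cnj ` upper_half_plane"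
  have \<gamma>: "0 < ?\<gamma>" "?\<gamma> < 1"
    using \<beta> by (auto simp: field_simps)
  have hol: "minus_powr ?\<gamma> holomorphic_on ?\<Omega>"
    using holomorphic_minus_powr univalence_region_avoids_slit by (rule holomorphic_on_subset)
  obtain g where holg: "g holomorphic_on minus_powr ?\<gamma> ` ?\<Omega>"
    and g: "\<And>\<zeta>. \<zeta> \<in> ?\<Omega> \<Longrightarrow> g (minus_powr ?\<gamma> \<zeta>) = \<zeta>"
    using holomorphic_has_inverse[OF hol open_univalence_region inj_on_minus_powr[OF \<gamma>]] by metis
  have gD: "g c \<in> ?\<Omega>" "minus_powr ?\<gamma> (g c) = c" if "c \<notin> \<real>\<^sub>\<le>\<^sub>0" for c
    using slit_plane_subset_image_minus_powr[OF \<beta>] that g by fastforce+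
  have D: "z - 1 \<notin> \<real>\<^sub>\<le>\<^sub>0" if "z \<in> ?D" for z
    using that by (auto simp: upper_half_plane_def ray_def complex_nonpos_Reals_iff)
  \<comment> \<open>Since \<open>g c - g c powr \<gamma> = c\<close>, subtracting \<open>c = z - 1\<close> from \<open>g c\<close> gives the power
      \<open>g c powr \<gamma>\<close>, that is \<open>w\<close>. The point \<open>z = 1\<close> is outside the domain of analyticity, and
      its boundary value is prescribed.\<close>
  define \<phi> where "\<phi> z = (if z = 1 then 1 else g (z - 1) - (z - 1))" for z
  have \<phi>_powr: "\<phi> z = g (z - 1) powr of_real ?\<gamma>" if "z - 1 \<notin> \<real>\<^sub>\<le>\<^sub>0" for z
  proof -
    have "z \<noteq> 1" using that by auto
    then show ?thesis
      using gD(2)[OF that] by (simp add: \<phi>_def minus_powr_def algebra_simps)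
  qed
  have \<phi>_real: "\<phi> (of_real (w powr \<beta> - w + 1)) = of_real w" if w: "1 < w" for w :: real
  proof -
    have "1 < w powr \<beta>"
      using w \<beta> by (intro gr_one_powr) auto
    then have "of_real (w powr \<beta>) \<in> ?\<Omega>"
      by (auto simp: univalence_region_def)
    from g[OF this] have "g (of_real (w powr \<beta> - w)) = of_real (w powr \<beta>)"
      using w \<beta> by (simp add: minus_powr_of_real_powr)
    moreover have "w powr 1 < w powr \<beta>"
      using w \<beta> by (intro powr_less_mono) auto
    then have "complex_of_real (w powr \<beta> - w + 1) \<noteq> 1"
      using w by (simp only: of_real_eq_1_iff) simp
    ultimately show ?thesis
      by (simp add: \<phi>_def)
  qed
  have "\<phi> holomorphic_on ?D"
  proof (rule holomorphic_transform)
    have "(g \<circ> (\<lambda>z. z - 1)) holomorphic_on ?D"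
    proof (rule holomorphic_on_compose_gen[OF _ holg])
      show "(\<lambda>z. z - 1) holomorphic_on ?D"
        by (rule holomorphic_on_diff[OF holomorphic_on_ident holomorphic_on_const])
      show "(\<lambda>z. z - 1) ` ?D \<subseteq> minus_powr ?\<gamma> ` ?\<Omega>"
        using slit_plane_subset_image_minus_powr[OF \<beta>] D by blast
    qed
    then have "(\<lambda>z. g (z - 1)) holomorphic_on ?D"
      by (simp add: o_def)
    then show "(\<lambda>z. g (z - 1) - (z - 1)) holomorphic_on ?D"
      by (rule holomorphic_on_diff)
        (rule holomorphic_on_diff[OF holomorphic_on_ident holomorphic_on_const])
    fix z assume "z \<in> ?D"
    then show "g (z - 1) - (z - 1) = \<phi> z"
      using D[of z] by (auto simp: \<phi>_def)
  qed
  moreover have "open ?D"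
  proof -
    have "?D = (\<lambda>z::complex. z - 1) -` (- \<real>\<^sub>\<le>\<^sub>0)"
    proof (intro equalityI subsetI)
      fix z :: complex assume "z \<in> (\<lambda>z. z - 1) -` (- \<real>\<^sub>\<le>\<^sub>0)"
      then consider "0 < Im z" | "Im z = 0" "1 < Re z" | "0 < Im (cnj z)"
        by (cases "Im z" "0::real" rule: linorder_cases) (auto simp: complex_nonpos_Reals_iff)
      then show "z \<in> ?D"
      proof cases
        case 2
        then have "z = of_real (Re z)" by (simp add: complex_eq_iff)
        then show ?thesis using 2 unfolding ray_def by blast
      next
        case 3
        then have "cnj z \<in> upper_half_plane"
          by (simp add: upper_half_plane_def)
        then show ?thesis
          by (metis UnI2 complex_cnj_cnj image_eqI)
      qed (simp add: upper_half_plane_def)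
    qed (use D in auto)
    moreover have "open ((\<lambda>z::complex. z - 1) -` (- \<real>\<^sub>\<le>\<^sub>0))"
      by (intro open_vimage continuous_intros) (auto simp: open_Compl)
    ultimately show ?thesis by simp
  qed
  ultimately have "\<phi> analytic_on ?D"
    by (simp add: analytic_on_open)
  moreover have "Im (\<phi> z) > 0" if z: "z \<in> upper_half_plane" for z
  proof -
    have *: "z - 1 \<notin> \<real>\<^sub>\<le>\<^sub>0" using D z by blast
    have "sgn (Im (g (z - 1))) = sgn (Im (z - 1))"
      using sgn_Im_minus_powr[OF \<gamma> gD(1)[OF *]] gD(2)[OF *] by simp
    then have "0 < Im (g (z - 1))"
      using z by (simp add: upper_half_plane_def sgn_1_pos)
    then show ?thesis
      using Im_powr_pos[OF \<gamma>] \<phi>_powr[OF *] by simp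
  qed
  moreover have "\<phi> (cnj z) = cnj (\<phi> z)" if z: "z \<in> upper_half_plane" for z
  proof -
    have *: "z - 1 \<notin> \<real>\<^sub>\<le>\<^sub>0" using D z by blast
    have "minus_powr ?\<gamma> (cnj (g (z - 1))) = cnj z - 1"
      using cnj_minus_powr gD[OF *] univalence_region_avoids_slit by fastforce
    then have "g (cnj z - 1) = cnj (g (z - 1))"
      using g[OF cnj_univalence_region[OF gD(1)[OF *]]] by simp
    then show ?thesis
      by (simp add: \<phi>_def)
  qed
  moreover have "\<phi> z \<in> \<real>" if z: "z \<in> ray" for z
  proof -
    obtain x where "1 < x" "z = of_real x" using z by (auto simp: ray_def)
    then show ?thesis
      using powr_minus_id_solvable[OF \<beta>, of x] \<phi>_real by (metis Reals_of_real)
  qed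
  moreover have "((\<lambda>x. \<phi> (complex_of_real x)) \<longlongrightarrow> 1) (at_right 1)"
  proof -
    have between: "\<exists>w. 1 < w \<and> w \<le> x \<and> \<phi> (of_real x) = of_real w" if "1 < x" for x :: real
      using powr_minus_id_solvable[OF \<beta> that] \<phi>_real by metis
    have gt1: "eventually (\<lambda>x::real. 1 < x) (at_right 1)"
      by (rule eventually_at_right_less)
    have "((\<lambda>x. Re (\<phi> (complex_of_real x))) \<longlongrightarrow> 1) (at_right 1)"
    proof (rule tendsto_sandwich[where f = "\<lambda>_. 1" and h = "\<lambda>x. x"])
      show "eventually (\<lambda>x. 1 \<le> Re (\<phi> (complex_of_real x))) (at_right 1)"
        using gt1 by eventually_elim (use between in fastforce)
      show "eventually (\<lambda>x. Re (\<phi> (complex_of_real x)) \<le> x) (at_right 1)"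
        using gt1 by eventually_elim (use between in fastforce)
    qed (auto intro: tendsto_ident_at)
    then have "((\<lambda>x. complex_of_real (Re (\<phi> (complex_of_real x)))) \<longlongrightarrow> of_real 1) (at_right 1)"
      by (rule tendsto_of_real)
    moreover have "eventually (\<lambda>x. complex_of_real (Re (\<phi> (complex_of_real x))) = \<phi> (complex_of_real x)) (at_right 1)"
      using gt1 by eventually_elim (use between in fastforce)
    ultimately show ?thesis
      using Lim_transform_eventually by fastforce
  qed
  moreover have "\<phi> 1 = 1"
    by (simp add: \<phi>_def)
  ultimately have "\<phi> \<in> PAL_class"
    by (simp add: PAL_class_def)
  then show thesis
    using that \<phi>_real by blast
qed

section \<open>The orbit of the critical point\<close>

lemma p_2_gt_1:
  assumes "\<alpha> > 1" "0 < a" "a < 1"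
  shows "1 < p 2 \<alpha> a"
proof -
  have "0 < a powr (\<alpha> - 1)"
    using assms by simp
  moreover have "a powr (\<alpha> - 1) < 1"
    using assms powr_less_mono2[of "\<alpha> - 1" a 1] by simp
  ultimately show ?thesis
    by (simp add: p_def one_less_inverse_iff)
qed

lemma p_3_eq_powr_minus_id:
  assumes "\<alpha> > 1" "0 < a" "a < 1"
  shows "p 3 \<alpha> a = p 2 \<alpha> a powr (\<alpha> + 1) - p 2 \<alpha> a + 1"
proof -
  define w where "w = p 2 \<alpha> a"
  define W where "W = w powr \<alpha>"
  have w: "1 < w" using p_2_gt_1[OF assms] by (simp add: w_def)
  then have W: "1 < W" using assms by (simp add: W_def gr_one_powr)
  have t: "a powr (\<alpha> - 1) = 1 - 1 / w"
    by (simp add: w_def p_def field_simps)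
  have "a powr \<alpha> = a * a powr (\<alpha> - 1)"
    using assms by (simp add: powr_mult_base)
  then have a_powr: "a powr \<alpha> = a * (1 - 1 / w)"
    by (simp add: t)
  have orb1: "orb \<alpha> a 1 = a"
    by (simp add: fmap_def)
  have orb2: "orb \<alpha> a 2 = a / w"
    using a_powr assms by (simp add: numeral_2_eq_2 fmap_def algebra_simps)
  have "orb \<alpha> a 3 = fmap \<alpha> a (orb \<alpha> a 2)"
    by (simp add: numeral_3_eq_3 numeral_2_eq_2)
  also have "\<dots> = a - a * (1 - 1 / w) / W"
    using assms w by (simp add: orb2 fmap_def powr_divide a_powr W_def)
  finally have orb3: "orb \<alpha> a 3 = a - a * (1 - 1 / w) / W" .
  have "p 3 \<alpha> a = (a - a * (1 - 1 / w) / W) / (a / w) *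
      ((a / w - a) / (- (a * (1 - 1 / w) / W)))"
    unfolding p_3_eq orb1 orb2 orb3 by simp
  also have "(a / w - a) / (- (a * (1 - 1 / w) / W)) = W"
    using assms w W by (simp add: field_simps)
  also have "(a - a * (1 - 1 / w) / W) / (a / w) * W = w * W - w + 1"
    using assms w W by (simp add: field_simps)
  also have "w * W = w powr (\<alpha> + 1)"
    using w by (simp add: W_def powr_add)
  finally show ?thesis
    by (simp add: w_def)
qed

theorem theorem1:
  fixes \<alpha> :: real
  assumes "\<alpha> > 1"
  shows "\<exists>\<phi> \<in> PAL_class. \<forall>a::real. 0 < a \<and> a < 1 \<longrightarrow>
           p 3 \<alpha> a > 1 \<and>
           \<phi> (complex_of_real (p 3 \<alpha> a)) = complex_of_real (p 2 \<alpha> a)"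
proof -
  have \<beta>: "2 \<le> \<alpha> + 1" using assms by simp
  obtain \<phi> where \<phi>: "\<phi> \<in> PAL_class"
    "\<And>w::real. 1 < w \<Longrightarrow> \<phi> (of_real (w powr (\<alpha> + 1) - w + 1)) = of_real w"
    using PAL_inverse_of_powr_minus_id[OF \<beta>] by blast
  have "p 3 \<alpha> a > 1 \<and> \<phi> (complex_of_real (p 3 \<alpha> a)) = complex_of_real (p 2 \<alpha> a)"
    if "0 < a" "a < 1" for a
  proof -
    have "1 < p 2 \<alpha> a"
      using p_2_gt_1 assms that by blast
    moreover from this have "p 2 \<alpha> a powr 1 < p 2 \<alpha> a powr (\<alpha> + 1)"
      using assms by (intro powr_less_mono) auto
    ultimately show ?thesis
      using \<phi>(2)[of "p 2 \<alpha> a"] p_3_eq_powr_minus_id[OF assms that] by simp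
  qed
  then show ?thesis
    using \<phi>(1) by blast
qed

end
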